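(* Let $\{\phi_i\}_{i=1}^N$ be a Parseval frame in $\mathbb{R}^M$. For $I\subseteq\{1,\dots,N\}$, let $I^c=\{1,\dots,N\}\setminus I$, $W_I=\operatorname{span}\{\phi_i\}_{i\in I}$ and $W_{I^c}=\operatorname{span}\{\phi_i\}_{i\in I^c}$. If $W_I\cap W_{I^c}=\{0\}$, then $W_I\perp W_{I^c}$.
   Context: A family $\{\phi_i\}_{i=1}^N$ in $\mathbb{R}^M$ is a Parseval frame if $\sum_{i=1}^N|\langle x,\phi_i\rangle|^2=\|x\|^2$ for all $x\in\mathbb{R}^M$. $W_I\perp W_{I^c}$ means every vector of $W_I$ is orthogonal to every vector of $W_{I^c}$. *)

theory Defs
  imports "HOL-Analysis.Analysis"
begin

definition parseval_frame :: "nat \<Rightarrow> (nat \<Rightarrow> real ^ 'm) \<Rightarrow> bool" where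
  "parseval_frame N \<phi> \<longleftrightarrow> (\<forall>x. (\<Sum>i=1..N. \<bar>x \<bullet> \<phi> i\<bar>\<^sup>2) = (norm x)\<^sup>2)"

end

theory Submission
  imports Defs
begin

text \<open>
  Polarizing the Parseval identity gives the reconstruction formula
  \<open>u = (\<Sum>i. (u \<bullet> \<phi> i) \<phi> i)\<close>. For \<open>u \<in> W\<^sub>I\<close> the part of this sum over the complement of \<open>I\<close>
  equals \<open>u\<close> minus the part over \<open>I\<close>, so it lies in both spans and vanishes. Pairing it with \<open>u\<close>
  turns it into the sum of the squares \<open>(u \<bullet> \<phi> i)\<^sup>2\<close> over the complement, so \<open>u\<close> is orthogonal to each
  of these \<open>\<phi> i\<close>, hence to their span.
\<close>

lemma parseval_frame_inner:
  assumes "parseval_frame N \<phi>"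
  shows "(\<Sum>i=1..N. (x \<bullet> \<phi> i) * (y \<bullet> \<phi> i)) = x \<bullet> y"
proof -
  have sq: "(\<Sum>i=1..N. (z \<bullet> \<phi> i)\<^sup>2) = z \<bullet> z" for z
    using assms by (simp add: parseval_frame_def power2_norm_eq_inner)
  have "(x + y) \<bullet> (x + y) = (\<Sum>i=1..N. (x \<bullet> \<phi> i)\<^sup>2 + (y \<bullet> \<phi> i)\<^sup>2 + 2 * ((x \<bullet> \<phi> i) * (y \<bullet> \<phi> i)))"
    unfolding sq[symmetric] by (simp add: inner_add_left power2_sum mult.assoc)
  also have "\<dots> = x \<bullet> x + y \<bullet> y + 2 * (\<Sum>i=1..N. (x \<bullet> \<phi> i) * (y \<bullet> \<phi> i))"
    by (simp only: sum.distrib sq sum_distrib_left[symmetric])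
  finally show ?thesis
    by (simp add: inner_add_left inner_add_right inner_commute)
qed

lemma parseval_frame_reconstruction:
  assumes "parseval_frame N \<phi>"
  shows "(\<Sum>i=1..N. (x \<bullet> \<phi> i) *\<^sub>R \<phi> i) = x"
proof (rule vector_eq_rdot[THEN iffD1], rule allI)
  fix z
  show "(\<Sum>i=1..N. (x \<bullet> \<phi> i) *\<^sub>R \<phi> i) \<bullet> z = x \<bullet> z"
    using parseval_frame_inner[OF assms, of x z]
    by (simp add: inner_sum_left inner_commute[of z])
qed

theorem corollary5p9:
  fixes \<phi> :: "nat \<Rightarrow> real ^ 'm" and N :: nat and I :: "nat set"
  assumes "parseval_frame N \<phi>"
    and "I \<subseteq> {1..N}"
    and "span (\<phi> ` I) \<inter> span (\<phi> ` ({1..N} - I)) = {0}"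
  shows "\<forall>u \<in> span (\<phi> ` I). \<forall>v \<in> span (\<phi> ` ({1..N} - I)). orthogonal u v"
proof (intro ballI)
  fix u v
  assume u: "u \<in> span (\<phi> ` I)" and v: "v \<in> span (\<phi> ` ({1..N} - I))"
  let ?J = "{1..N} - I"
  define w where "w = (\<Sum>i\<in>?J. (u \<bullet> \<phi> i) *\<^sub>R \<phi> i)"
  have "w + (\<Sum>i\<in>I. (u \<bullet> \<phi> i) *\<^sub>R \<phi> i) = u"
    unfolding w_def using sum.subset_diff[OF assms(2), of "\<lambda>i. (u \<bullet> \<phi> i) *\<^sub>R \<phi> i"]
    by (simp add: parseval_frame_reconstruction[OF assms(1), simplified])
  then have "w = u - (\<Sum>i\<in>I. (u \<bullet> \<phi> i) *\<^sub>R \<phi> i)"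
    by (simp add: algebra_simps)
  then have "w \<in> span (\<phi> ` I)"
    using u by (auto intro!: span_diff span_sum span_scale intro: span_base)
  moreover have "w \<in> span (\<phi> ` ?J)"
    unfolding w_def by (intro span_sum span_scale span_base imageI)
  ultimately have "w = 0"
    using assms(3) by blast
  then have "(\<Sum>i\<in>?J. (u \<bullet> \<phi> i)\<^sup>2) = 0"
    using inner_sum_right[of u "\<lambda>i. (u \<bullet> \<phi> i) *\<^sub>R \<phi> i" ?J]
    by (simp add: w_def power2_eq_square)
  then have "\<forall>i\<in>?J. u \<bullet> \<phi> i = 0"
    by (simp add: sum_nonneg_eq_0_iff)
  then show "orthogonal u v"
    by (intro orthogonal_to_span[OF v]) (auto simp: orthogonal_def)
qed

end
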